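(* Let $k$ and $n$ be positive integers with $k<n$ and such that $k>8(n-k)^2$. Then $$\psi_1(n,k)\leq\frac{8(n-k)^2}{k-8(n-k)^2}.$$
   Context: For a set $K\subset\mathbb{C}$ and $\epsilon>0$, $K_\epsilon=\{z\in\mathbb{C}: \inf_{w\in K}|z-w|<\epsilon\}$ denotes the $\epsilon$-neighborhood of $K$. The critical points of a polynomial $p$ are the zeros of $p'$; zeros and critical points are counted with multiplicity. Property $\mathcal{AGL}(n,k,\epsilon)$ (approximate Gauss--Lucas property) of a set $K$: every degree $n$ polynomial $p\in\mathbb{C}[z]$ with at least $k$ zeros lying in $K$ has at least $k-1$ critical points lying in $K_\epsilon$. For $R\geq 0$ let $D_R$ be the closed disk centered at the origin with radius $R$. The quantity $\psi_R(n,k)$ is the smallest possible $\epsilon$ in the sense of the infimum: $\psi_R(n,k)=\inf\{\epsilon>0 : D_R \text{ satisfies } \mathcal{AGL}(n,k,\epsilon)\}$. In particular $\psi_1(n,k)$ refers to the closed unit disk (radius $1$). *)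

theory Defs
  imports "HOL-Analysis.Analysis" "HOL-Computational_Algebra.Computational_Algebra"
begin

(* The library sets infdist z {} = 0, whereas an infimum over the empty set should be infinite;
   hence the nonemptiness condition. *)
definition eps_nbhd :: "complex set \<Rightarrow> real \<Rightarrow> complex set" where
  "eps_nbhd K e = {z. K \<noteq> {} \<and> infdist z K < e}"

definition zeros_in :: "complex poly \<Rightarrow> complex set \<Rightarrow> nat" where
  "zeros_in p S = size (filter_mset (\<lambda>z. z \<in> S) (proots p))"

definition AGL :: "nat \<Rightarrow> nat \<Rightarrow> real \<Rightarrow> complex set \<Rightarrow> bool" where
  "AGL n k e K \<longleftrightarrow>
     (\<forall>p :: complex poly. degree p = n \<and> zeros_in p K \<ge> k
        \<longrightarrow> zeros_in (pderiv p) (eps_nbhd K e) \<ge> k - 1)"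

(* Taken in the extended reals, so that the value is infinite if no epsilon is admissible;
   the real Inf of the empty set would be an arbitrary number. *)
definition psi :: "real \<Rightarrow> nat \<Rightarrow> nat \<Rightarrow> ereal" where
  "psi R n k = Inf {ereal e | e. e > 0 \<and> AGL n k e (cball 0 R)}"

end

theory Submission
  imports Defs "HOL-Complex_Analysis.Residue_Theorem"
begin

text \<open>
  Write \<open>p = c q r\<close>, where \<open>q\<close> collects the zeros in the closed unit disk, and let \<open>m = n - k\<close>, so
  that \<open>r\<close> has at most \<open>m\<close> zeros. On a circle \<open>\<bar>z\<bar> = \<rho> > 1\<close>, the bound
  \<open>Re (z / (z - a)) \<ge> \<rho> / (1 + \<rho>)\<close> for \<open>\<bar>a\<bar> \<le> 1\<close> gives \<open>\<bar>q' / q\<bar> \<ge> k / (1 + \<rho>)\<close>; in particular all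
  critical points of \<open>q\<close> lie in the unit disk. Put \<open>d = m (2 + e) / k\<close>. If \<open>2 m d < e\<close>, the intervals of
  radius \<open>d\<close> around the moduli of the zeros of \<open>r\<close> do not cover \<open>(1, 1 + e)\<close>, and for a radius \<open>\<rho>\<close>
  outside of them \<open>\<bar>r' / r\<bar> \<le> m / d = k / (2 + e) < k / (1 + \<rho>)\<close>. So \<open>q' r\<close> dominates \<open>q r'\<close> on that
  circle, and by Rouche's theorem \<open>p'\<close> has at least as many zeros inside it as \<open>q'\<close>.
\<close>

section \<open>Zero counts as sums of orders, and Rouche's theorem for polynomials\<close>

lemma zeros_in_eq_sum_order:
  assumes "p \<noteq> 0"
  shows "zeros_in p S = (\<Sum>z\<in>{z\<in>S. poly p z = 0}. order z p)"
proof -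
  have "zeros_in p S = (\<Sum>z\<in>set_mset (filter_mset (\<lambda>z. z \<in> S) (proots p)).
      count (filter_mset (\<lambda>z. z \<in> S) (proots p)) z)"
    unfolding zeros_in_def by (rule size_multiset_overloaded_eq)
  also have "\<dots> = (\<Sum>z\<in>{z\<in>S. poly p z = 0}. order z p)"
    using assms by (intro sum.cong) auto
  finally show ?thesis .
qed

lemma zorder_poly:
  fixes p :: "complex poly"
  assumes "p \<noteq> 0"
  shows "zorder (poly p) z = int (order z p)"
proof -
  obtain q where q: "p = [:- z, 1:] ^ order z p * q" "\<not> [:- z, 1:] dvd q"
    using order_decomp[OF assms] by blast
  show ?thesis
  proof (rule zorder_eqI[where S = UNIV])
    show "poly q z \<noteq> 0"
      using q(2) by (simp add: poly_eq_0_iff_dvd)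
    show "poly p w = poly q w * (w - z) powi int (order z p)" for w
      by (subst q(1)) (simp add: poly_power power_int_def algebra_simps)
  qed (auto intro!: holomorphic_intros)
qed

text \<open>Identifies the weighted sums in the general Rouche theorem with \<open>zeros_in\<close>:
  the winding number is 1 inside the circle and 0 outside, no zero lies on the circle, and
  \<open>zorder\<close> is the multiplicity.\<close>

lemma sum_winding_number_circlepath_zorder:
  fixes p :: "complex poly"
  assumes "r > 0" "p \<noteq> 0" "\<And>z. cmod z = r \<Longrightarrow> poly p z \<noteq> 0"
  shows "(\<Sum>z | poly p z = 0. winding_number (circlepath 0 r) z * zorder (poly p) z)
    = of_nat (zeros_in p (ball 0 r))"
proof -
  have "(\<Sum>z | poly p z = 0. winding_number (circlepath 0 r) z * zorder (poly p) z)
      = (\<Sum>z\<in>{z\<in>ball 0 r. poly p z = 0}. of_nat (order z p))"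
  proof (rule sum.mono_neutral_cong_right)
    show "finite {z. poly p z = 0}"
      using assms poly_roots_finite by blast
    show "\<forall>z\<in>{z. poly p z = 0} - {z \<in> ball 0 r. poly p z = 0}.
        winding_number (circlepath 0 r) z * zorder (poly p) z = 0"
    proof
      fix z assume "z \<in> {z. poly p z = 0} - {z \<in> ball 0 r. poly p z = 0}"
      then have "z \<notin> cball 0 r"
        using assms(3)[of z] by auto
      then have "winding_number (circlepath 0 r) z = 0"
        using assms(1) by (intro winding_number_zero_outside[where s = "cball 0 r"]) auto
      then show "winding_number (circlepath 0 r) z * zorder (poly p) z = 0" by simp
    qed
  qed (use assms in \<open>auto simp: zorder_poly winding_number_circlepath\<close>)
  then show ?thesis
    by (simp add: zeros_in_eq_sum_order assms)
qed

lemma poly_Rouche: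
  assumes "r > 0" and less: "\<And>z. cmod z = r \<Longrightarrow> cmod (poly q z) < cmod (poly p z)"
  shows "zeros_in (p + q) (ball 0 r) = zeros_in p (ball 0 r)"
proof -
  have nz: "poly (p + q) z \<noteq> 0" "poly p z \<noteq> 0" if "cmod z = r" for z
  proof -
    show "poly p z \<noteq> 0" using less[OF that] by auto
    have "cmod (poly p z) \<noteq> cmod (poly q z)" using less[OF that] by simp
    then show "poly (p + q) z \<noteq> 0" by (metis add_eq_0_iff norm_minus_cancel poly_add)
  qed
  \<comment> \<open>One point of the circle at which both polynomials are nonzero shows that neither
    is the zero polynomial.\<close>
  have "cmod (of_real r) = r" using \<open>r > 0\<close> by simp
  from nz[OF this] have ne: "p + q \<noteq> 0" "p \<noteq> 0" by (metis poly_0)+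
  have "(\<Sum>z\<in>{z\<in>UNIV. poly p z + poly q z = 0}. winding_number (circlepath 0 r) z * zorder (\<lambda>z. poly p z + poly q z) z)
      = (\<Sum>z\<in>{z\<in>UNIV. poly p z = 0}. winding_number (circlepath 0 r) z * zorder (poly p) z)"
  proof (rule Rouche_theorem)
    show "finite {z \<in> UNIV. poly p z + poly q z = 0}" "finite {z \<in> UNIV. poly p z = 0}"
      using poly_roots_finite[OF ne(1)] poly_roots_finite[OF ne(2)] by simp_all
    show "\<forall>z\<in>path_image (circlepath 0 r). cmod (poly q z) < cmod (poly p z)"
      using assms by (auto simp: path_image_circlepath)
  qed (auto intro!: holomorphic_intros)
  then have "(\<Sum>z | poly (p + q) z = 0. winding_number (circlepath 0 r) z * zorder (poly (p + q)) z)
      = (\<Sum>z | poly p z = 0. winding_number (circlepath 0 r) z * zorder (poly p) z)"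
    by (simp add: poly_add[abs_def])
  then have "(of_nat (zeros_in (p + q) (ball 0 r)) :: complex) = of_nat (zeros_in p (ball 0 r))"
    by (simp only: sum_winding_number_circlepath_zorder[OF \<open>r > 0\<close>] nz ne not_False_eq_True)
  then show ?thesis by (simp only: of_nat_eq_iff)
qed

section \<open>Products of linear factors and bounds for their logarithmic derivatives\<close>

lemma poly_pderiv_prod_mset:
  fixes A :: "'a :: field_char_0 multiset"
  assumes "z \<notin># A"
  shows "poly (pderiv (\<Prod>a\<in>#A. [:-a, 1:])) z
    = poly (\<Prod>a\<in>#A. [:-a, 1:]) z * (\<Sum>a\<in>#A. 1 / (z - a))"
  using assms
proof (induction A)
  case (add x A)
  then have "z - x \<noteq> 0" "z \<notin># A" by auto
  let ?P = "\<Prod>a\<in>#A. [:-a, 1:]"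
  have "poly (pderiv ([:-x, 1:] * ?P)) z = poly ?P z + (z - x) * poly (pderiv ?P) z"
    by (simp add: pderiv_mult pderiv_pCons algebra_simps del: mult_pCons_left)
  also have "\<dots> = (z - x) * poly ?P z * (1 / (z - x) + (\<Sum>a\<in>#A. 1 / (z - a)))"
    using add.IH \<open>z \<notin># A\<close> \<open>z - x \<noteq> 0\<close> by (simp add: distrib_left)
  also have "(z - x) * poly ?P z = poly ([:-x, 1:] * ?P) z"
    by (simp add: algebra_simps)
  finally show ?case by simp
qed auto

lemma poly_prod_mset_linear_eq_0_iff:
  fixes A :: "'a :: field multiset"
  shows "poly (\<Prod>a\<in>#A. [:-a, 1:]) z = 0 \<longleftrightarrow> z \<in># A"
  by (induction A) auto

lemma degree_prod_mset_linear:
  fixes A :: "'a :: field multiset"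
  shows "degree (\<Prod>a\<in>#A. [:-a, 1:]) = size A"
proof (induction A)
  case (add x A)
  have "(\<Prod>a\<in>#A. [:-a, 1:]) \<noteq> 0" by auto
  with add show ?case by (simp add: degree_mult_eq del: mult_pCons_left)
qed auto

text \<open>With \<open>t = Re (z * cnj a)\<close>, the real part equals (|z|^2 - t) / |z - a|^2.
  Bounding |a|^2 by 1 in the denominator reduces the claim to (|z| - 1) (|z| + t) \<ge> 0, which
  holds because |t| \<le> |z|. Equality occurs at a = -z / |z|.\<close>

lemma Re_divide_diff_ge:
  fixes z a :: complex
  assumes "cmod a \<le> 1" "cmod z > 1"
  shows "Re (z / (z - a)) \<ge> cmod z / (1 + cmod z)"
proof -
  define t where "t = Re (z * cnj a)"
  let ?r = "cmod z"
  have "\<bar>t\<bar> \<le> ?r * cmod a"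
    using abs_Re_le_cmod[of "z * cnj a"] by (simp add: t_def norm_mult)
  also have "\<dots> \<le> ?r"
    using assms by (simp add: mult_left_le)
  finally have t: "?r + t \<ge> 0" by linarith
  have "z - a \<noteq> 0" using assms by auto
  then have pos: "(cmod (z - a))\<^sup>2 > 0" by simp
  have "(cmod (z - a))\<^sup>2 = ?r\<^sup>2 - 2 * t + (cmod a)\<^sup>2"
    unfolding t_def cmod_power2 by (simp add: power2_eq_square algebra_simps)
  moreover have "(cmod a)\<^sup>2 \<le> 1" using assms by (simp add: power_le_one)
  ultimately have "?r * (cmod (z - a))\<^sup>2 \<le> ?r * (?r\<^sup>2 - 2 * t + 1)"
    by (intro mult_left_mono) auto
  also have "\<dots> = (?r\<^sup>2 - t) * (1 + ?r) - (?r - 1) * (?r + t)"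
    by (simp add: power2_eq_square algebra_simps)
  also have "\<dots> \<le> (?r\<^sup>2 - t) * (1 + ?r)"
    using assms t by simp
  finally have "?r / (1 + ?r) \<le> (?r\<^sup>2 - t) / (cmod (z - a))\<^sup>2"
    using pos assms by (simp add: field_simps)
  also have "\<dots> = Re (z / (z - a))"
    unfolding complex_div_cnj[of z "z - a"] t_def Re_divide_of_real
    by (simp add: cmod_power2[of z] power2_eq_square[of "Re z"] power2_eq_square[of "Im z"] right_diff_distrib)
  finally show ?thesis .
qed

text \<open>After multiplication by \<open>z\<close> every summand has a positive real part that is
  bounded below, so the terms cannot cancel. The real part bounds the modulus, and the factor
  \<open>cmod z\<close> is cancelled at the end.\<close>

lemma cmod_sum_inverse_diff_ge:
  fixes A :: "complex multiset"
  assumes "\<And>a. a \<in># A \<Longrightarrow> cmod a \<le> 1" "cmod z > 1"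
  shows "size A / (1 + cmod z) \<le> cmod (\<Sum>a\<in>#A. 1 / (z - a))"
proof -
  have "cmod z * (size A / (1 + cmod z)) \<le> Re (z * (\<Sum>a\<in>#A. 1 / (z - a)))"
    using assms(1)
  proof (induction A)
    case (add a A)
    have "cmod z / (1 + cmod z) \<le> Re (z / (z - a))"
      using add.prems assms(2) by (intro Re_divide_diff_ge) auto
    with add show ?case
      by (simp add: distrib_left add_divide_distrib)
  qed auto
  also have "\<dots> \<le> cmod z * cmod (\<Sum>a\<in>#A. 1 / (z - a))"
    using complex_Re_le_cmod[of "z * (\<Sum>a\<in>#A. 1 / (z - a))"] by (simp only: norm_mult)
  finally show ?thesis
    by (rule mult_left_le_imp_le) (use assms(2) in linarith)
qed

lemma cmod_sum_inverse_diff_le: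
  fixes B :: "complex multiset"
  assumes "\<And>b. b \<in># B \<Longrightarrow> d \<le> \<bar>cmod z - cmod b\<bar>" "d > 0"
  shows "cmod (\<Sum>b\<in>#B. 1 / (z - b)) \<le> size B / d"
  using assms(1)
proof (induction B)
  case (add b B)
  have "d \<le> cmod (z - b)"
    using add.prems[of b] norm_triangle_ineq3[of z b] by simp
  then have "cmod (1 / (z - b)) \<le> 1 / d"
    using assms(2) by (simp add: norm_divide frac_le)
  moreover have "cmod (\<Sum>b\<in>#B. 1 / (z - b)) \<le> size B / d"
    using add by auto
  ultimately show ?case
    using norm_triangle_ineq[of "1 / (z - b)" "\<Sum>b\<in>#B. 1 / (z - b)"]
    by (simp add: add_divide_distrib)
qed auto

text \<open>Gauss-Lucas for the unit disk: outside of it the logarithmic derivative is nonzero by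
  the lower bound above, so every root of the derivative is counted, and their number is its
  degree.\<close>

lemma zeros_in_pderiv_disc:
  fixes A :: "complex multiset"
  assumes "\<And>a. a \<in># A \<Longrightarrow> cmod a \<le> 1" "r > 1"
  shows "zeros_in (pderiv (\<Prod>a\<in>#A. [:-a, 1:])) (ball 0 r) = size A - 1"
proof (cases "A = {#}")
  \<comment> \<open>The empty product is 1 with derivative 0; by convention \<open>proots 0\<close>
    is empty, which matches the truncated difference 0 - 1 = 0.\<close>
  case True
  then show ?thesis by (simp add: zeros_in_def)
next
  case False
  let ?q = "\<Prod>a\<in>#A. [:-a, 1:]"
  have "cmod z < r" if "poly (pderiv ?q) z = 0" for z
  proof (rule ccontr)
    assume "\<not> cmod z < r"
    then have z: "cmod z > 1" using assms by simp
    then have "z \<notin># A" using assms(1)[of z] by auto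
    moreover have "cmod (\<Sum>a\<in>#A. 1 / (z - a)) > 0"
      using cmod_sum_inverse_diff_ge[of A z] assms(1) z False
      by (smt (verit, best) divide_pos_pos of_nat_0_less_iff size_eq_0_iff_empty neq0_conv)
    ultimately have "poly (pderiv ?q) z \<noteq> 0"
      by (subst poly_pderiv_prod_mset) (auto simp: poly_prod_mset_linear_eq_0_iff)
    with that show False by simp
  qed
  moreover have "pderiv ?q \<noteq> 0"
    using False by (simp add: pderiv_eq_0_iff degree_prod_mset_linear)
  ultimately have "filter_mset (\<lambda>z. z \<in> ball 0 r) (proots (pderiv ?q)) = proots (pderiv ?q)"
    by (simp add: filter_mset_eq_conv)
  then show ?thesis
    by (simp add: zeros_in_def size_proots_complex degree_pderiv degree_prod_mset_linear)
qed

section \<open>Radii far from finitely many points, rules for zero counts, and the neighborhood of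
  the disk\<close>

lemma exists_far_from_mset:
  fixes B :: "real multiset" and a b d :: real
  assumes "2 * d * size B < b - a" "d \<ge> 0"
  shows "\<exists>x\<in>{a<..<b}. \<forall>y\<in>#B. \<bar>x - y\<bar> > d"
proof (rule ccontr)
  assume "\<not> ?thesis"
  then have sub: "{a<..<b} \<subseteq> (\<Union>y\<in>set_mset B. cball y d)"
    by (force simp: dist_real_def abs_minus_commute not_less)
  have "0 \<le> 2 * d * size B" using assms by simp
  then have ab: "a \<le> b" using assms by linarith
  \<comment> \<open>Compare Lebesgue measures: if no such point existed, intervals of length
    \<open>2 * d\<close> would cover an interval longer than their total length.\<close>
  have "ennreal (b - a) = emeasure lborel {a<..<b}"
    using ab by simp
  also have "\<dots> \<le> emeasure lborel (\<Union>y\<in>set_mset B. cball y d)"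
    by (intro emeasure_mono sub) auto
  also have "\<dots> \<le> (\<Sum>y\<in>set_mset B. emeasure lborel (cball y d))"
    by (intro emeasure_subadditive_finite) auto
  also have "\<dots> = (\<Sum>y\<in>set_mset B. ennreal (2 * d))"
    using assms by (intro sum.cong) (auto simp: cball_eq_atLeastAtMost)
  also have "\<dots> = ennreal (2 * d * card (set_mset B))"
    using assms by (simp add: ennreal_mult'' mult.commute ennreal_of_nat_eq_real_of_nat)
  finally have "b - a \<le> 2 * d * card (set_mset B)"
    using assms by (subst (asm) ennreal_le_iff) auto
  \<comment> \<open>The cover has one interval per distinct point, while \<open>size\<close> counts
    multiplicities.\<close>
  also have "\<dots> \<le> 2 * d * size B"
  proof -
    have "card (set_mset B) \<le> size B"
      by (induction B) (auto simp: card_insert_if)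
    then show ?thesis using assms by (intro mult_left_mono) auto
  qed
  finally show False using assms by simp
qed

lemma zeros_in_mult:
  assumes "p \<noteq> 0" "q \<noteq> 0"
  shows "zeros_in (p * q) S = zeros_in p S + zeros_in q S"
  using assms by (simp add: zeros_in_def proots_mult)

lemma zeros_in_smult: "c \<noteq> 0 \<Longrightarrow> zeros_in (smult c p) S = zeros_in p S"
  by (simp add: zeros_in_def)

lemma zeros_in_mono:
  assumes "S \<subseteq> T"
  shows "zeros_in p S \<le> zeros_in p T"
proof -
  have "filter_mset (\<lambda>z. z \<in> S) (proots p) = filter_mset (\<lambda>z. z \<in> S) (filter_mset (\<lambda>z. z \<in> T) (proots p))"
    using assms by (auto simp: filter_filter_mset intro!: filter_mset_cong)
  then show ?thesis
    unfolding zeros_in_def by (metis size_filter_mset_lesseq)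
qed

lemma ball_subset_eps_nbhd_cball:
  assumes "e > 0"
  shows "ball 0 (1 + e) \<subseteq> eps_nbhd (cball 0 1) e"
proof
  fix z :: complex assume z: "z \<in> ball 0 (1 + e)"
  have "infdist z (cball 0 1) < e"
  proof (cases "cmod z \<le> 1")
    case True
    then show ?thesis using assms by simp
  next
    case False
    have "z \<noteq> 0" using False by auto
    \<comment> \<open>For \<open>z\<close> outside the disk, \<open>sgn z\<close> is its radial
      projection to the unit circle.\<close>
    then have "z - sgn z = (cmod z - 1) *\<^sub>R sgn z"
      by (simp add: sgn_div_norm scaleR_conv_of_real field_simps)
    then have "dist z (sgn z) = cmod z - 1"
      using False \<open>z \<noteq> 0\<close> by (simp add: dist_norm norm_sgn)
    moreover have "sgn z \<in> cball 0 1" by (simp add: norm_sgn)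
    then have "infdist z (cball 0 1) \<le> dist z (sgn z)" by (rule infdist_le)
    ultimately show ?thesis using z by simp
  qed
  then show "z \<in> eps_nbhd (cball 0 1) e" by (simp add: eps_nbhd_def)
qed

section \<open>Domination on a suitable circle, and the resulting bound\<close>

lemma zeros_in_pderiv_mult_ge:
  fixes A B :: "complex multiset" and k m :: nat and e :: real
  assumes A: "\<And>a. a \<in># A \<Longrightarrow> cmod a \<le> 1" and sizes: "k \<le> size A" "size B \<le> m" and pos: "0 < k" "0 < m"
    and e: "e > 0" "2 * real m ^ 2 * (2 + e) < k * e"
  shows "size A - 1 \<le> zeros_in (pderiv ((\<Prod>a\<in>#A. [:-a, 1:]) * (\<Prod>b\<in>#B. [:-b, 1:]))) (ball 0 (1 + e))"
proof -
  define q where "q = (\<Prod>a\<in>#A. [:-a, 1:])"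
  define r where "r = (\<Prod>b\<in>#B. [:-b, 1:])"
  \<comment> \<open>Chosen so that m / d = k / (2 + e), which is strictly below k / (1 +
    \<open>\<rho>\<close>) for every \<open>\<rho>\<close> < 1 + e. The second assumption on
    \<open>e\<close> is exactly 2 d m < e with the denominator \<open>k\<close> cleared, so a radius
    at distance more than \<open>d\<close> from all moduli in \<open>B\<close> exists.\<close>
  define d where "d = m * (2 + e) / k"
  have d: "d > 0" using pos e by (simp add: d_def)
  have "2 * d * size (image_mset cmod B) \<le> 2 * d * m"
    using d sizes by simp
  also have "\<dots> < e"
    using e pos by (simp add: d_def field_simps power2_eq_square)
  finally obtain \<rho> where \<rho>: "1 < \<rho>" "\<rho> < 1 + e" and dist: "\<And>b. b \<in># B \<Longrightarrow> d < \<bar>\<rho> - cmod b\<bar>"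
    using exists_far_from_mset[of d "image_mset cmod B" "1 + e" 1] d by force
  have less: "cmod (poly (q * pderiv r) z) < cmod (poly (pderiv q * r) z)" if z: "cmod z = \<rho>" for z
  proof -
    have notin: "z \<notin># A" "z \<notin># B"
      using A[of z] dist[of z] z \<rho> d by auto
    have "cmod (\<Sum>b\<in>#B. 1 / (z - b)) \<le> size B / d"
      using dist z d by (intro cmod_sum_inverse_diff_le) (auto intro: less_imp_le)
    also have "\<dots> \<le> m / d"
      using sizes d by (simp add: divide_right_mono)
    also have "\<dots> = k / (2 + e)"
      using pos e by (simp add: d_def)
    also have "\<dots> < k / (1 + \<rho>)"
      using pos \<rho> by (intro divide_strict_left_mono) auto
    also have "\<dots> \<le> size A / (1 + cmod z)"
      using sizes \<rho> z by (simp add: divide_right_mono)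
    also have "\<dots> \<le> cmod (\<Sum>a\<in>#A. 1 / (z - a))"
      using A z \<rho> by (intro cmod_sum_inverse_diff_ge) auto
    finally have "cmod (\<Sum>b\<in>#B. 1 / (z - b)) < cmod (\<Sum>a\<in>#A. 1 / (z - a))" .
    \<comment> \<open>Both products contain the nonzero factor q(z) r(z); dividing by it leaves the
      comparison of logarithmic derivatives just proved.\<close>
    moreover have "poly q z \<noteq> 0" "poly r z \<noteq> 0"
      using notin unfolding q_def r_def poly_prod_mset_linear_eq_0_iff by auto
    moreover have "poly (pderiv q) z = poly q z * (\<Sum>a\<in>#A. 1 / (z - a))"
        "poly (pderiv r) z = poly r z * (\<Sum>b\<in>#B. 1 / (z - b))"
      unfolding q_def r_def using notin by (simp_all only: poly_pderiv_prod_mset not_False_eq_True)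
    ultimately show ?thesis
      by (simp add: norm_mult)
  qed
  \<comment> \<open>At any point of the circle the dominating side is positive, so neither of its
    factors is the zero polynomial.\<close>
  have "cmod (of_real \<rho>) = \<rho>" using \<rho> by simp
  from less[OF this] have ne: "pderiv q \<noteq> 0" "r \<noteq> 0" by auto
  have "size A - 1 = zeros_in (pderiv q) (ball 0 \<rho>)"
    unfolding q_def using A \<rho> by (intro zeros_in_pderiv_disc[symmetric])
  also have "\<dots> \<le> zeros_in (pderiv q * r) (ball 0 \<rho>)"
    using ne by (simp add: zeros_in_mult)
  also have "\<dots> = zeros_in (pderiv q * r + q * pderiv r) (ball 0 \<rho>)"
    using less \<rho> by (intro poly_Rouche[symmetric]) auto
  also have "\<dots> = zeros_in (pderiv (q * r)) (ball 0 \<rho>)"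
    by (simp add: pderiv_mult algebra_simps)
  also have "\<dots> \<le> zeros_in (pderiv (q * r)) (ball 0 (1 + e))"
    using \<rho> by (intro zeros_in_mono) auto
  finally show ?thesis unfolding q_def r_def .
qed

lemma AGL_unit_disc:
  assumes "0 < k" "k < n" "e > 0" "2 * real (n - k) ^ 2 * (2 + e) < k * e"
  shows "AGL n k e (cball 0 1)"
  unfolding AGL_def
proof (intro allI impI)
  fix p :: "complex poly" assume p: "degree p = n \<and> k \<le> zeros_in p (cball 0 1)"
  define A where "A = filter_mset (\<lambda>z. z \<in> cball 0 1) (proots p)"
  define B where "B = filter_mset (\<lambda>z. z \<notin> cball 0 1) (proots p)"
  let ?f = "\<lambda>M :: complex multiset. \<Prod>a\<in>#M. [:-a, 1:]"
  have c: "lead_coeff p \<noteq> 0" using p assms by auto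
  have AB: "proots p = A + B" unfolding A_def B_def by (rule multiset_partition)
  have sA: "k \<le> size A" using p by (simp add: A_def zeros_in_def)
  \<comment> \<open>Over the complex numbers the roots with multiplicity number \<open>n\<close>; as
    at least \<open>k\<close> lie in the disk, at most \<open>n - k\<close> remain for
    \<open>B\<close>.\<close>
  have "size A + size B = n" using AB p size_proots_complex[of p] by simp
  then have sB: "size B \<le> n - k" using sA by simp
  have "p = smult (lead_coeff p) (?f A * ?f B)"
    using complex_poly_decompose_multiset[of p] by (simp add: AB)
  then have pd: "pderiv p = smult (lead_coeff p) (pderiv (?f A * ?f B))"
    by (metis pderiv_smult)
  have "k - 1 \<le> size A - 1" using sA by simp
  also have "\<dots> \<le> zeros_in (pderiv (?f A * ?f B)) (ball 0 (1 + e))"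
    by (rule zeros_in_pderiv_mult_ge[where k = k and m = "n - k"]) (use sA sB assms in \<open>auto simp: A_def\<close>)
  also have "\<dots> = zeros_in (pderiv p) (ball 0 (1 + e))"
    by (simp only: pd zeros_in_smult[OF c])
  also have "\<dots> \<le> zeros_in (pderiv p) (eps_nbhd (cball 0 1) e)"
    using assms by (intro zeros_in_mono ball_subset_eps_nbhd_cball)
  finally show "k - 1 \<le> zeros_in (pderiv p) (eps_nbhd (cball 0 1) e)" .
qed

theorem corollary1p3:
  fixes n k :: nat
  assumes "k > 0" and "n > 0" and "k < n"
    and "real k > 8 * (real n - real k)^2"
  shows "psi 1 n k \<le> ereal (8 * (real n - real k)^2 / (real k - 8 * (real n - real k)^2))"
proof -
  define M where "M = (real n - real k)\<^sup>2"
  define e where "e = 8 * M / (k - 8 * M)"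
  have M: "M > 0" "8 * M < k" using assms by (auto simp: M_def)
  then have e: "e > 0" by (simp add: e_def)
  \<comment> \<open>The bound in the theorem is the solution \<open>e\<close> of this linear
    equation. The right side exceeds \<open>2 * M * (2 + e)\<close> by 4 M + 6 M e > 0, so
    \<open>e\<close> itself is admissible in the infimum and no limiting argument is
    required.\<close>
  have "k * e = 8 * M * (1 + e)"
    using M by (simp add: e_def field_simps)
  then have "2 * M * (2 + e) < k * e"
    using mult_pos_pos[OF M(1) e] M by (simp add: algebra_simps)
  then have "AGL n k e (cball 0 1)"
    using assms e by (intro AGL_unit_disc) (auto simp: M_def)
  then have "psi 1 n k \<le> ereal e"
    unfolding psi_def using e by (intro Inf_lower) auto
  then show ?thesis by (simp add: e_def M_def)
qed

end
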